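(* Let $G$ be a finite connected simple graph on $n\ge 2$ vertices with minimum degree $\delta$, and let $0=\lambda_1<\lambda_2\le\dots\le\lambda_n$ be the eigenvalues of its Laplacian matrix. Suppose a terminating chip-firing game with $N$ chips was played on $G$ and let $s$ be the total number of firings. Then $$ s \leq 2nN\cdot \frac{\lambda_2+\frac{\lambda_n(n-1)}{n}-\delta}{\lambda_2\lambda_n}.$$
   Context: Chip-firing game: a configuration is a vector $\mathbf a\in\mathbb Z_{\ge 0}^n$ ($a_i$ chips on vertex $i$), with $N=\sum_i a_i$ chips. Vertex $i$ of degree $d_i$ may fire if $a_i\ge d_i$; firing moves one chip from $i$ to each neighbour of $i$. A terminating game is a finite sequence of legal firings from an initial configuration ending in a configuration in which no vertex can fire; $s$ is the length of this sequence. The Laplacian $L$ has $L_{ii}=d_i$, $L_{ij}=-1$ for adjacent $i\ne j$, $0$ otherwise. *)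

theory Defs
  imports
    "Graph_Theory.Pair_Digraph"
    "Graph_Theory.Digraph_Component"
    "Jordan_Normal_Form.Char_Poly"
    "HOL-Computational_Algebra.Fundamental_Theorem_Algebra"
begin

text \<open>
  A finite simple graph is a \<^locale>\<open>pair_graph\<close>: a finite, loop-free, symmetric digraph without
  parallel arcs. Each edge is the pair of arcs \<open>(u, v)\<close> and \<open>(v, u)\<close>, so the degree of a
  vertex is its out-degree.
\<close>

abbreviation vertex_degree :: "'a pair_pre_digraph \<Rightarrow> 'a \<Rightarrow> nat" where
  "vertex_degree G v \<equiv> out_degree (with_proj G) v"

definition min_degree :: "'a pair_pre_digraph \<Rightarrow> nat" where
  "min_degree G = Min (vertex_degree G ` pverts G)"


type_synonym 'a config = "'a \<Rightarrow> nat"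

definition num_chips :: "'a pair_pre_digraph \<Rightarrow> 'a config \<Rightarrow> nat" where
  "num_chips G a = (\<Sum>v\<in>pverts G. a v)"

definition can_fire :: "'a pair_pre_digraph \<Rightarrow> 'a config \<Rightarrow> 'a \<Rightarrow> bool" where
  "can_fire G a v \<longleftrightarrow> v \<in> pverts G \<and> vertex_degree G v \<le> a v"

text \<open>The truncated subtraction is exact whenever \<open>can_fire G a v\<close> holds.\<close>

definition fire :: "'a pair_pre_digraph \<Rightarrow> 'a \<Rightarrow> 'a config \<Rightarrow> 'a config" where
  "fire G v a = (\<lambda>w. if w = v then a w - vertex_degree G v
                      else if (v, w) \<in> parcs G then a w + 1 else a w)"

primrec legal_game :: "'a pair_pre_digraph \<Rightarrow> 'a config \<Rightarrow> 'a list \<Rightarrow> 'a config \<Rightarrow> bool" where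
  "legal_game G a [] b \<longleftrightarrow> b = a"
| "legal_game G a (v # vs) b \<longleftrightarrow> can_fire G a v \<and> legal_game G (fire G v a) vs b"

definition terminating_game ::
    "'a pair_pre_digraph \<Rightarrow> 'a config \<Rightarrow> 'a list \<Rightarrow> 'a config \<Rightarrow> bool" where
  "terminating_game G a vs b \<longleftrightarrow> legal_game G a vs b \<and> (\<forall>v. \<not> can_fire G b v)"


text \<open>Used for graphs whose vertex set is \<open>{0..<n}\<close>.\<close>

definition laplacian :: "nat pair_pre_digraph \<Rightarrow> real mat" where
  "laplacian G = mat (card (pverts G)) (card (pverts G))
     (\<lambda>(i, j). if i = j then real (vertex_degree G i)
               else if (i, j) \<in> parcs G then - 1 else 0)"

text \<open>
  The eigenvalues in ascending order, repeated according to multiplicity; there are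
  \<open>card (pverts G)\<close> of them (lemma \<open>char_poly_laplacian\<close>).
\<close>

definition laplacian_spectrum :: "nat pair_pre_digraph \<Rightarrow> real list" where
  "laplacian_spectrum G = sorted_list_of_multiset (proots (char_poly (laplacian G)))"

text \<open>The \<open>k\<close>-th smallest eigenvalue, counted from \<open>k = 1\<close>.\<close>

definition laplacian_eigenvalue :: "nat pair_pre_digraph \<Rightarrow> nat \<Rightarrow> real" where
  "laplacian_eigenvalue G k = laplacian_spectrum G ! (k - 1)"

lemma laplacian_carrier [simp]:
  "laplacian G \<in> carrier_mat (card (pverts G)) (card (pverts G))"
  by (simp add: laplacian_def)

lemma real_eigenvalue_symmetric:
  fixes A :: "real mat"
  assumes A: "A \<in> carrier_mat n n"
    and sym: "\<And>i j. i < n \<Longrightarrow> j < n \<Longrightarrow> A $$ (i, j) = A $$ (j, i)"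
    and root: "poly (char_poly (map_mat complex_of_real A)) z = 0"
  shows "z \<in> \<real>"
proof -
  let ?B = "map_mat complex_of_real A"
  have B: "?B \<in> carrier_mat n n" using A by simp
  from root have "eigenvalue ?B z"
    using eigenvalue_root_char_poly[OF B] by simp
  then obtain v where v: "v \<in> carrier_vec n" "v \<noteq> 0\<^sub>v n" "?B *\<^sub>v v = z \<cdot>\<^sub>v v"
    unfolding eigenvalue_def eigenvector_def using A by auto
  have ev: "(\<Sum>j<n. complex_of_real (A $$ (i, j)) * v $ j) = z * v $ i" if "i < n" for i
  proof -
    have "(?B *\<^sub>v v) $ i = (\<Sum>j<n. complex_of_real (A $$ (i, j)) * v $ j)"
      using that A v(1) by (auto simp: scalar_prod_def lessThan_atLeast0 intro!: sum.cong)
    then show ?thesis using that v(1) by (simp add: v(3))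
  qed
  define T where
    "T = (\<Sum>i<n. \<Sum>j<n. complex_of_real (A $$ (i, j)) * v $ j * cnj (v $ i))"
  define S where "S = (\<Sum>i<n. (cmod (v $ i))\<^sup>2)"
  have T: "T = z * complex_of_real S"
  proof -
    have "T = (\<Sum>i<n. (z * v $ i) * cnj (v $ i))"
      unfolding T_def by (intro sum.cong refl) (simp flip: sum_distrib_right ev)
    also have "\<dots> = z * complex_of_real S"
      unfolding S_def of_real_sum sum_distrib_left
      by (intro sum.cong refl) (simp add: mult.assoc complex_norm_square del: of_real_power)
    finally show ?thesis .
  qed
  have "cnj T = (\<Sum>i<n. \<Sum>j<n. complex_of_real (A $$ (i, j)) * cnj (v $ j) * v $ i)"
    unfolding T_def by simp
  also have "\<dots> = (\<Sum>j<n. \<Sum>i<n. complex_of_real (A $$ (i, j)) * cnj (v $ j) * v $ i)"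
    by (rule sum.swap)
  also have "\<dots> = T"
    unfolding T_def by (intro sum.cong refl) (simp add: sym mult_ac)
  finally have "T \<in> \<real>" by (simp add: Reals_cnj_iff)
  obtain i where i: "i < n" "v $ i \<noteq> 0"
    using v(1,2) by (metis carrier_vecD eq_vecI index_zero_vec(1) index_zero_vec(2))
  then have "(cmod (v $ i))\<^sup>2 > 0" by simp
  then have "S > 0" unfolding S_def
    using i(1) by (intro sum_pos2[of _ i]) auto
  then have "z = T / complex_of_real S" using T by simp
  then show ?thesis using \<open>T \<in> \<real>\<close> by simp
qed

lemma char_poly_symmetric_splits:
  fixes A :: "real mat"
  assumes A: "A \<in> carrier_mat n n"
    and sym: "\<And>i j. i < n \<Longrightarrow> j < n \<Longrightarrow> A $$ (i, j) = A $$ (j, i)"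
  shows "\<exists>es. length es = n \<and> char_poly A = (\<Prod>e\<leftarrow>es. [:- e, 1:])"
proof -
  interpret h: map_poly_inj_idom_hom complex_of_real ..
  let ?B = "map_mat complex_of_real A"
  have B: "?B \<in> carrier_mat n n" using A by simp
  obtain cs where cs: "char_poly ?B = (\<Prod>c\<leftarrow>cs. [:- c, 1:])" "length cs = n"
    using char_poly_factorized[OF B] by blast
  have "c \<in> \<real>" if "c \<in> set cs" for c
  proof (rule real_eigenvalue_symmetric[OF A sym])
    show "poly (char_poly ?B) c = 0"
      unfolding cs(1) poly_prod_list prod_list_zero_iff using that by (auto simp: image_iff)
  qed
  then have cs_real: "map (complex_of_real \<circ> Re) cs = cs"
    by (auto intro!: map_idI simp: of_real_Re)
  have "map_poly complex_of_real (char_poly A) = char_poly ?B"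
    by (rule of_real_hom.char_poly_hom[OF A, symmetric])
  also have "\<dots> = (\<Prod>e\<leftarrow>map Re cs. [:- complex_of_real e, 1:])"
    by (subst cs(1), subst cs_real[symmetric]) (simp add: comp_def)
  also have "\<dots> = map_poly complex_of_real (\<Prod>e\<leftarrow>map Re cs. [:- e, 1:])"
    by (simp add: h.hom_prod_list comp_def)
  finally have "char_poly A = (\<Prod>e\<leftarrow>map Re cs. [:- e, 1:])"
    using h.injectivity by blast
  then show ?thesis using cs(2) by (intro exI[of _ "map Re cs"]) simp
qed

lemma char_poly_laplacian:
  assumes G: "pair_graph G" and V: "pverts G = {0..<n}"
  shows "length (laplacian_spectrum G) = n"
    and "sorted (laplacian_spectrum G)"
    and "char_poly (laplacian G) = (\<Prod>e\<leftarrow>laplacian_spectrum G. [:- e, 1:])"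
proof -
  interpret pair_graph G by fact
  have L: "laplacian G \<in> carrier_mat n n"
    using laplacian_carrier[of G] V by simp
  have sym: "laplacian G $$ (i, j) = laplacian G $$ (j, i)" if "i < n" "j < n" for i j
  proof -
    have "(i, j) \<in> parcs G \<longleftrightarrow> (j, i) \<in> parcs G"
      using pair_sym_arcs by (auto simp: symmetric_def dest: symD)
    then show ?thesis using that V by (simp add: laplacian_def)
  qed
  obtain es where es: "length es = n" "char_poly (laplacian G) = (\<Prod>e\<leftarrow>es. [:- e, 1:])"
    using char_poly_symmetric_splits[OF L sym] by blast
  have "proots (\<Prod>e\<leftarrow>es. [:- e, 1:]) = mset es" for es :: "real list"
  proof (induction es)
    case (Cons e es)
    have "(\<Prod>e\<leftarrow>es. [:- e, 1:]) \<noteq> 0" by (auto simp: prod_list_zero_iff)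
    then show ?case using Cons by (simp add: proots_mult del: mult_pCons_left)
  qed simp
  then have ms: "mset (laplacian_spectrum G) = mset es"
    by (simp add: laplacian_spectrum_def es(2))
  show "length (laplacian_spectrum G) = n" using ms es(1) by (metis size_mset)
  show "sorted (laplacian_spectrum G)" by (simp add: laplacian_spectrum_def)
  have "prod_mset (image_mset (\<lambda>e. [:- e, 1:]) (mset (laplacian_spectrum G))) =
        prod_mset (image_mset (\<lambda>e. [:- e, 1:]) (mset es))" by (simp only: ms)
  then show "char_poly (laplacian G) = (\<Prod>e\<leftarrow>laplacian_spectrum G. [:- e, 1:])"
    unfolding es(2) by (simp flip: mset_map add: prod_mset_prod_list)
qed

end

theory Submission
  imports Defs "Jordan_Normal_Form.Schur_Decomposition"
begin

text \<open>
  Let \<open>x\<close> count the firings of each vertex, so \<open>L x = a - b\<close>, and let \<open>z\<close> be a vertex that never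
  fires. With \<open>M\<close> the pseudoinverse of \<open>L\<close>, the vector \<open>x - M (a - b)\<close> is constant, equal to
  \<open>s / n\<close>; reading off entry \<open>z\<close> gives \<open>s / n = (M (b - a))\<^sub>z\<close>. Since \<open>b - a\<close> has
  \<open>l\<^sup>1\<close>-norm at most \<open>2 N\<close>, it suffices to bound the entries of \<open>M\<close>, and by positive
  semidefiniteness only those on the diagonal. There
  \<open>1 / \<lambda> \<le> (\<lambda>\<^sub>2 + \<lambda>\<^sub>n - \<lambda>) / (\<lambda>\<^sub>2 \<lambda>\<^sub>n)\<close> on \<open>[\<lambda>\<^sub>2, \<lambda>\<^sub>n]\<close>
  reduces \<open>M\<^sub>i\<^sub>i\<close> to the known entry \<open>L\<^sub>i\<^sub>i = d\<^sub>i \<ge> \<delta>\<close>.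
\<close>

section \<open>Spectral theorem for real symmetric matrices\<close>

text \<open>Basis completion followed by Gram-Schmidt leaves the first vector unchanged, so after
  normalisation the first column is still parallel to \<open>v\<close>. This supplies the change of
  basis for one deflation step of the diagonalization.\<close>

lemma orthogonal_mat_with_first_column:
  fixes v :: "real vec"
  assumes v: "v \<in> carrier_vec n" and v0: "v \<noteq> 0\<^sub>v n"
  obtains W c where "W \<in> carrier_mat n n" "W\<^sup>T * W = 1\<^sub>m n" "col W 0 = c \<cdot>\<^sub>v v"
proof -
  interpret cof_vec_space n "TYPE(real)" .
  have n: "n \<noteq> 0"
    using v v0 by (metis carrier_vecD vec_of_dim_0)
  define b where "b = basis_completion v"
  define ws where "ws = gram_schmidt n b"
  from basis_completion[OF v v0, folded b_def]
  have dist_b: "distinct b" and indep: "\<not> lin_dep (set b)" and b: "set b \<subseteq> carrier_vec n"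
    and hdb: "hd b = v" and len_b: "length b = n"
    by auto
  from hdb len_b n obtain vs where bv: "b = v # vs" by (cases b) auto
  from gram_schmidt_result[OF b dist_b indep refl, folded ws_def]
  have ws: "set ws \<subseteq> carrier_vec n" "corthogonal ws" "length ws = n"
    by (auto simp: len_b)
  from gram_schmidt_hd[OF v, of vs, folded bv] have hdws: "hd ws = v" unfolding ws_def .
  define c where "c w = 1 / sqrt (w \<bullet> w)" for w :: "real vec"
  define W where "W = mat_of_cols n (map (\<lambda>w. c w \<cdot>\<^sub>v w) ws)"
  have dim: "ws ! i \<in> carrier_vec n" if "i < n" for i
    using ws that by (auto simp: subset_iff)
  have col: "col W i = c (ws ! i) \<cdot>\<^sub>v ws ! i" if "i < n" for i
    using that ws dim[OF that] by (simp add: W_def)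
  have W: "W \<in> carrier_mat n n"
    using ws(3) mat_of_cols_carrier(1)[of n "map (\<lambda>w. c w \<cdot>\<^sub>v w) ws"] by (simp add: W_def)
  have orth: "ws ! i \<bullet> ws ! j = 0 \<longleftrightarrow> i \<noteq> j" if "i < n" "j < n" for i j
    using corthogonalD[OF ws(2), of i j] that ws(3) by simp
  have "W\<^sup>T * W = 1\<^sub>m n"
  proof (rule eq_matI)
    fix i j assume "i < dim_row (1\<^sub>m n :: real mat)" "j < dim_col (1\<^sub>m n :: real mat)"
    then have ij: "i < n" "j < n" by auto
    have "(W\<^sup>T * W) $$ (i, j) = col W i \<bullet> col W j"
      using W ij by simp
    also have "\<dots> = c (ws ! i) * (c (ws ! j) * (ws ! i \<bullet> ws ! j))"
      using dim[OF ij(1)] dim[OF ij(2)] by (simp add: col ij)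
    also have "\<dots> = 1\<^sub>m n $$ (i, j)"
    proof (cases "i = j")
      case True
      have "ws ! i \<bullet> ws ! i > 0"
        using orth[of i i] ij
        by (simp add: scalar_prod_def less_le sum_nonneg)
      then show ?thesis using True ij by (simp add: c_def)
    qed (use orth ij in simp)
    finally show "(W\<^sup>T * W) $$ (i, j) = 1\<^sub>m n $$ (i, j)" .
  qed (use W in auto)
  moreover have "col W 0 = c v \<cdot>\<^sub>v v"
    using col[of 0] n hdws ws(3) by (simp add: hd_conv_nth flip: length_greater_0_conv)
  ultimately show ?thesis using W that by blast
qed

text \<open>Deflation: an orthogonal conjugation with an eigenvector in the first column splits off
  \<open>e\<close> as a 1 by 1 block, and the induction hypothesis treats the remaining symmetric
  block. The diagonal follows the order of the given list \<open>es\<close>, so a sorted spectrum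
  yields sorted diagonal entries.\<close>

lemma real_symmetric_diagonalization:
  fixes A :: "real mat"
  assumes "A \<in> carrier_mat n n" "A\<^sup>T = A" "char_poly A = (\<Prod>e\<leftarrow>es. [:- e, 1:])"
  shows "\<exists>U \<in> carrier_mat n n. U\<^sup>T * U = 1\<^sub>m n \<and> U\<^sup>T * A * U = mat_diag n ((!) es)"
  using assms
proof (induction es arbitrary: n A)
  case Nil
  then have "n = 0" using degree_monic_char_poly[of A n] by simp
  then show ?case using Nil by (intro bexI[of _ "1\<^sub>m 0"]) (auto simp: mat_diag_def)
next
  case (Cons e es n A)
  note A = Cons.prems(1) and sym = Cons.prems(2)
  define m where "m = n - 1"
  have cp: "char_poly A = [:- e, 1:] * (\<Prod>e\<leftarrow>es. [:- e, 1:])"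
    using Cons.prems(3) by simp
  have "poly (char_poly A) e = 0" by (simp add: cp)
  then have "eigenvalue A e" by (simp add: eigenvalue_root_char_poly[OF A])
  then obtain v where v: "v \<in> carrier_vec n" "v \<noteq> 0\<^sub>v n" "A *\<^sub>v v = e \<cdot>\<^sub>v v"
    unfolding eigenvalue_def eigenvector_def using A by auto
  then have n: "n = 1 + m"
    unfolding m_def by (cases n) auto
  obtain W c where W: "W \<in> carrier_mat n n" "W\<^sup>T * W = 1\<^sub>m n" "col W 0 = c \<cdot>\<^sub>v v"
    using orthogonal_mat_with_first_column[OF v(1,2)] by blast
  have WW: "W * W\<^sup>T = 1\<^sub>m n"
    using mat_mult_left_right_inverse[OF _ W(1,2)] W(1) by simp
  define A' where "A' = W\<^sup>T * A * W"
  have A': "A' \<in> carrier_mat n n" using A W by (simp add: A'_def)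
  have "similar_mat_wit A' A (W\<^sup>T) W"
    by (rule similar_mat_witI[of _ _ n]) (use A A' W WW in \<open>auto simp: A'_def\<close>)
  then have "similar_mat A' A" unfolding similar_mat_def by blast
  then have cp': "char_poly A' = char_poly A" by (rule char_poly_similar)
  have sym': "A'\<^sup>T = A'"
    using A W by (simp add: A'_def transpose_mult[of _ n n _ n] sym assoc_mult_mat[of _ n n _ n _ n])
  have sym_idx: "A' $$ (i, j) = A' $$ (j, i)" if "i < n" "j < n" for i j
    using arg_cong[OF sym', of "\<lambda>M. M $$ (i, j)"] A' that by simp
  \<comment> \<open>Column 0 of \<open>W\<close> is an eigenvector of \<open>A\<close>, and the
    columns of \<open>W\<close> are orthonormal. By symmetry the first row vanishes off the diagonal
    as well, which gives \<open>block\<close>.\<close>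
  have col0: "A' $$ (i, 0) = (if i = 0 then e else 0)" if i: "i < n" for i
  proof -
    have "A' $$ (i, 0) = (W\<^sup>T * (A * W)) $$ (i, 0)"
      using A W by (simp add: A'_def assoc_mult_mat[of _ n n _ n _ n])
    also have "\<dots> = col W i \<bullet> col (A * W) 0"
      using A W(1) i n by simp
    also have "col (A * W) 0 = A *\<^sub>v col W 0"
      using n by (intro col_mult2[OF A W(1)]) simp
    also have "A *\<^sub>v col W 0 = e \<cdot>\<^sub>v col W 0"
      using A v by (simp add: W(3) mult_mat_vec smult_smult_assoc mult.commute)
    also have "col W i \<bullet> (e \<cdot>\<^sub>v col W 0) = e * (W\<^sup>T * W) $$ (i, 0)"
      using W(1) i n by simp
    also have "\<dots> = (if i = 0 then e else 0)" using i n by (simp add: W(2))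
    finally show ?thesis .
  qed
  define D where "D = mat m m (\<lambda>(i, j). A' $$ (Suc i, Suc j))"
  have D: "D \<in> carrier_mat m m" by (simp add: D_def)
  define E where "E = mat 1 1 (\<lambda>_. e)"
  have E: "E \<in> carrier_mat 1 1" by (simp add: E_def)
  have block: "A' = four_block_mat E (0\<^sub>m 1 m) (0\<^sub>m m 1) D"
  proof (rule eq_matI)
    fix i j
    assume "i < dim_row (four_block_mat E (0\<^sub>m 1 m) (0\<^sub>m m 1) D)"
      "j < dim_col (four_block_mat E (0\<^sub>m 1 m) (0\<^sub>m m 1) D)"
    then have ij: "i < n" "j < n" by (auto simp: E_def D_def n)
    then show "A' $$ (i, j) = four_block_mat E (0\<^sub>m 1 m) (0\<^sub>m m 1) D $$ (i, j)"
      using col0[of i] col0[of j] sym_idx[of i j] n by (auto simp: E_def D_def)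
  qed (use A' in \<open>auto simp: E_def D_def n\<close>)
  have "char_poly A' = char_poly E * char_poly D"
    unfolding block by (rule char_poly_four_block_zeros_col[OF E _ D]) simp
  moreover have "char_poly E = [:- e, 1:]"
    by (simp add: E_def char_poly_defs det_def sign_def)
  ultimately have cpD: "char_poly D = (\<Prod>e\<leftarrow>es. [:- e, 1:])"
    using cp cp' by (metis mult_cancel_left pCons_eq_0_iff zero_neq_one)
  have symD: "D\<^sup>T = D"
    by (rule eq_matI) (auto simp: D_def n sym_idx)
  obtain V where V: "V \<in> carrier_mat m m" "V\<^sup>T * V = 1\<^sub>m m" "V\<^sup>T * D * V = mat_diag m ((!) es)"
    using Cons.IH[OF D symD cpD] by blast
  define V' where "V' = four_block_mat (1\<^sub>m 1) (0\<^sub>m 1 m) (0\<^sub>m m 1) V"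
  have V': "V' \<in> carrier_mat n n" using V(1) by (auto simp: V'_def n)
  have V'T: "V'\<^sup>T = four_block_mat (1\<^sub>m 1) (0\<^sub>m 1 m) (0\<^sub>m m 1) V\<^sup>T"
    unfolding V'_def by (subst transpose_four_block_mat) (use V(1) in auto)
  have V'V': "V'\<^sup>T * V' = 1\<^sub>m n"
    unfolding V'T unfolding V'_def
    by (subst mult_four_block_mat[of _ 1 1 _ m _ m _ _ 1 _ m]) (use V in \<open>auto simp: n\<close>)
  have VA: "V'\<^sup>T * A' = four_block_mat E (0\<^sub>m 1 m) (0\<^sub>m m 1) (V\<^sup>T * D)"
    unfolding V'T block
    by (subst mult_four_block_mat[of _ 1 1 _ m _ m _ _ 1 _ m]) (use V(1) D E in auto)
  have "V'\<^sup>T * A' * V' = four_block_mat E (0\<^sub>m 1 m) (0\<^sub>m m 1) (V\<^sup>T * D * V)"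
    unfolding VA unfolding V'_def
    by (subst mult_four_block_mat[of _ 1 1 _ m _ m _ _ 1 _ m]) (use V(1) D E in auto)
  also have "\<dots> = mat_diag n ((!) (e # es))"
    unfolding V(3)
    by (rule eq_matI) (auto simp: E_def mat_diag_def n nth_Cons' less_Suc_eq_0_disj
        split: if_splits)
  finally have diag: "V'\<^sup>T * A' * V' = mat_diag n ((!) (e # es))" .
  have "(W * V')\<^sup>T * (W * V') = V'\<^sup>T * (W\<^sup>T * W) * V'"
    using W(1) V' by (simp add: transpose_mult[of _ n n _ n] assoc_mult_mat[of _ n n _ n _ n])
  then have "(W * V')\<^sup>T * (W * V') = 1\<^sub>m n"
    using V' by (simp add: W(2) V'V')
  moreover have "(W * V')\<^sup>T * A * (W * V') = V'\<^sup>T * A' * V'"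
    unfolding A'_def using A W(1) V'
    by (simp add: transpose_mult[of _ n n _ n] assoc_mult_mat[of _ n n _ n _ n])
  ultimately show ?case
    using W(1) V' diag by (intro bexI[of _ "W * V'"]) auto
qed

text \<open>Here \<open>f k i\<close> is entry \<open>i\<close> of the \<open>k\<close>-th
  eigenvector, that is, entry \<open>(i, k)\<close> of the diagonalizing matrix. Since that matrix
  is square, its orthonormal columns force orthonormal rows, which is the second (completeness)
  relation.\<close>

lemma symmetric_orthonormal_eigenbasis:
  fixes A :: "real mat"
  assumes A: "A \<in> carrier_mat n n" and sym: "A\<^sup>T = A"
    and cp: "char_poly A = (\<Prod>e\<leftarrow>es. [:- e, 1:])"
  obtains f :: "nat \<Rightarrow> nat \<Rightarrow> real"
  where "\<And>k l. k < n \<Longrightarrow> l < n \<Longrightarrow> (\<Sum>i<n. f k i * f l i) = (if k = l then 1 else 0)"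
    and "\<And>i j. i < n \<Longrightarrow> j < n \<Longrightarrow> (\<Sum>k<n. f k i * f k j) = (if i = j then 1 else 0)"
    and "\<And>k i. k < n \<Longrightarrow> i < n \<Longrightarrow> (\<Sum>j<n. A $$ (i, j) * f k j) = es ! k * f k i"
proof -
  obtain U where U: "U \<in> carrier_mat n n" "U\<^sup>T * U = 1\<^sub>m n" "U\<^sup>T * A * U = mat_diag n ((!) es)"
    using real_symmetric_diagonalization[OF assms] by blast
  have UU: "U * U\<^sup>T = 1\<^sub>m n"
    using mat_mult_left_right_inverse[OF _ U(1,2)] U(1) by simp
  have "A * U = (U * U\<^sup>T) * (A * U)"
    using A U(1) UU by simp
  also have "\<dots> = U * mat_diag n ((!) es)"
    unfolding U(3)[symmetric] using A U(1) by (simp add: assoc_mult_mat[of _ n n _ n _ n])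
  finally have AU: "A * U = mat n n (\<lambda>(i, j). U $$ (i, j) * es ! j)"
    by (simp add: mat_diag_mult_right[OF U(1)])
  define f where "f k i = U $$ (i, k)" for k i
  show thesis
  proof (rule that[of f])
    fix k l assume "k < n" "l < n"
    then show "(\<Sum>i<n. f k i * f l i) = (if k = l then 1 else 0)"
      using arg_cong[OF U(2), of "\<lambda>M. M $$ (k, l)"] U(1)
      by (simp add: f_def scalar_prod_def lessThan_atLeast0)
  next
    fix i j assume "i < n" "j < n"
    then show "(\<Sum>k<n. f k i * f k j) = (if i = j then 1 else 0)"
      using arg_cong[OF UU, of "\<lambda>M. M $$ (i, j)"] U(1)
      by (simp add: f_def scalar_prod_def lessThan_atLeast0)
  next
    fix k i assume "k < n" "i < n"
    then show "(\<Sum>j<n. A $$ (i, j) * f k j) = es ! k * f k i"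
      using arg_cong[OF AU, of "\<lambda>M. M $$ (i, k)"] U(1) A
      by (simp add: f_def scalar_prod_def lessThan_atLeast0 mult.commute)
  qed
qed

section \<open>Firing counts\<close>

lemma vertex_degree_eq_sum:
  assumes "pair_graph G"
  shows "real (vertex_degree G v) = (\<Sum>w\<in>pverts G. if (v, w) \<in> parcs G then 1 else 0)"
proof -
  interpret pair_graph G by fact
  have "out_arcs (with_proj G) v = Pair v ` {w \<in> pverts G. (v, w) \<in> parcs G}"
    by (auto simp: out_arcs_def dest: in_arcsD2)
  then have "vertex_degree G v = card {w \<in> pverts G. (v, w) \<in> parcs G}"
    by (simp add: out_degree_def card_image inj_on_def)
  then show ?thesis
    using pair_finite_verts by (simp flip: sum.inter_filter)
qed

lemma parcs_sym_iff: "pair_graph G \<Longrightarrow> (u, v) \<in> parcs G \<longleftrightarrow> (v, u) \<in> parcs G"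
proof -
  assume "pair_graph G"
  then interpret pair_graph G .
  show ?thesis using pair_sym_arcs by (auto simp: symmetric_def dest: symD)
qed

lemma legal_game_append:
  "legal_game G a (us @ vs) b \<longleftrightarrow> (\<exists>c. legal_game G a us c \<and> legal_game G c vs b)"
  by (induction us arbitrary: a) auto

lemma legal_game_subset: "legal_game G a vs b \<Longrightarrow> set vs \<subseteq> pverts G"
  by (induction vs arbitrary: a) (auto simp: can_fire_def)

text \<open>Induction over the game. Legality makes the truncated subtraction in \<open>fire\<close>
  exact, so the identity can be stated over the reals.\<close>

lemma legal_game_balance:
  assumes G: "pair_graph G" and "legal_game G a vs b"
  shows "real (b w) = real (a w) - real (vertex_degree G w) * real (count_list vs w)
    + (\<Sum>v\<in>pverts G. if (v, w) \<in> parcs G then real (count_list vs v) else 0)"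
  using assms(2)
proof (induction vs arbitrary: a)
  case (Cons v vs)
  interpret pair_graph G by fact
  have v: "v \<in> pverts G" "vertex_degree G v \<le> a v"
    using Cons.prems by (auto simp: can_fire_def)
  have "(v, v) \<notin> parcs G" using pair_no_loops[of "(v, v)"] by auto
  then have fire: "real (fire G v a w) = real (a w)
      - (if w = v then real (vertex_degree G v) else 0) + (if (v, w) \<in> parcs G then 1 else 0)"
    using v(2) by (auto simp: fire_def of_nat_diff)
  have "(\<Sum>u\<in>pverts G. if (u, w) \<in> parcs G then real (count_list (v # vs) u) else 0)
      = (\<Sum>u\<in>pverts G. (if (u, w) \<in> parcs G then real (count_list vs u) else 0)
          + (if v = u then if (v, w) \<in> parcs G then 1 else 0 else 0))"
    by (intro sum.cong) auto
  also have "\<dots> = (\<Sum>u\<in>pverts G. if (u, w) \<in> parcs G then real (count_list vs u) else 0)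
          + (if (v, w) \<in> parcs G then 1 else 0)"
    using v(1) pair_finite_verts by (simp add: sum.distrib)
  finally show ?case
    using Cons.IH[of "fire G v a"] Cons.prems by (auto simp: fire algebra_simps)
qed (auto cong: if_cong)

text \<open>Among the elements of \<open>V\<close>, \<open>v\<close> is the one whose last
  occurrence in \<open>vs\<close> comes first. It is found by dropping the head as long as the tail
  still covers \<open>V\<close>.\<close>

lemma shortest_covering_suffix:
  assumes "V \<subseteq> set vs" "V \<noteq> {}"
  obtains us v ws where "vs = us @ v # ws" "V \<subseteq> insert v (set ws)" "v \<in> V" "v \<notin> set ws"
proof -
  have "\<exists>us v ws. vs = us @ v # ws \<and> V \<subseteq> insert v (set ws) \<and> v \<in> V \<and> v \<notin> set ws"
    using assms
  proof (induction vs)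
    case (Cons v vs)
    show ?case
    proof (cases "V \<subseteq> set vs")
      case True
      then show ?thesis using Cons by (metis append_Cons)
    next
      case False
      then show ?thesis using Cons.prems by (intro exI[of _ "[]"] exI[of _ v] exI[of _ vs]) auto
    qed
  qed auto
  then show thesis using that by blast
qed

text \<open>
  If every vertex fires, the vertex whose last firing comes first receives a chip from each
  neighbour afterwards, so it can still fire at the end.
\<close>

lemma terminating_game_unfired_vertex:
  assumes G: "pair_graph G" and "pverts G \<noteq> {}" and "terminating_game G a vs b"
  obtains z where "z \<in> pverts G" "z \<notin> set vs"
proof (rule ccontr)
  assume "\<not> thesis"
  with that have "pverts G \<subseteq> set vs" by blast
  then obtain us v ws where vs: "vs = us @ v # ws" "pverts G \<subseteq> insert v (set ws)"
      "v \<in> pverts G" "v \<notin> set ws"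
    using assms(2) by (rule shortest_covering_suffix)
  interpret pair_graph G by fact
  from assms(3) vs(1) obtain c where c: "legal_game G c ws b"
    by (auto simp: terminating_game_def legal_game_append)
  have "real (vertex_degree G v) = (\<Sum>u\<in>pverts G. if (u, v) \<in> parcs G then 1 else 0)"
    by (simp add: vertex_degree_eq_sum[OF G] parcs_sym_iff[OF G, of v])
  also have "\<dots> \<le> (\<Sum>u\<in>pverts G. if (u, v) \<in> parcs G then real (count_list ws u) else 0)"
  proof (rule sum_mono)
    fix u assume "u \<in> pverts G"
    \<comment> \<open>There are no loops, so a neighbour \<open>u\<close> differs from
      \<open>v\<close> and must occur in \<open>ws\<close>.\<close>
    have "count_list ws u \<ge> 1" if "(u, v) \<in> parcs G"
      using that vs(2) \<open>u \<in> pverts G\<close> pair_no_loops[of "(u, v)"] count_list_0_iff[of ws u]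
      by (cases "count_list ws u") auto
    then show "(if (u, v) \<in> parcs G then 1 else 0)
        \<le> (if (u, v) \<in> parcs G then real (count_list ws u) else 0)" by simp
  qed
  \<comment> \<open>Since \<open>v\<close> does not fire during \<open>ws\<close>, the balance has
    no negative term at \<open>v\<close>, and the chips \<open>c v\<close> already there can only
    help.\<close>
  also have "\<dots> \<le> real (b v)"
    using vs(4) by (simp add: legal_game_balance[OF G c, of v] count_list_0_iff)
  finally have "can_fire G b v" using vs(3) by (simp add: can_fire_def)
  then show False using assms(3) by (simp add: terminating_game_def)
qed

section \<open>Laplacian\<close>

lemma laplacian_entry:
  assumes "pair_graph G" and "pverts G = {0..<n}" and "i < n" "j < n"
  shows "laplacian G $$ (i, j)
    = (if i = j then real (vertex_degree G i) else 0) - (if (i, j) \<in> parcs G then 1 else 0)"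
proof -
  interpret pair_graph G by fact
  show ?thesis
    using assms pair_no_loops[of "(i, i)"] by (auto simp: laplacian_def)
qed

lemma laplacian_sum:
  assumes G: "pair_graph G" and V: "pverts G = {0..<n}" and i: "i < n"
  shows "(\<Sum>j<n. laplacian G $$ (i, j) * y j)
    = (\<Sum>j<n. if (i, j) \<in> parcs G then y i - y j else 0)"
proof -
  have "(\<Sum>j<n. laplacian G $$ (i, j) * y j)
      = (\<Sum>j<n. (if i = j then real (vertex_degree G i) * y i else 0)
          - (if (i, j) \<in> parcs G then y j else 0))"
    by (intro sum.cong) (auto simp: laplacian_entry[OF G V i] left_diff_distrib)
  also have "\<dots> = real (vertex_degree G i) * y i - (\<Sum>j<n. if (i, j) \<in> parcs G then y j else 0)"
    using i by (simp add: sum_subtractf)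
  also have "real (vertex_degree G i) * y i = (\<Sum>j<n. if (i, j) \<in> parcs G then y i else 0)"
    unfolding vertex_degree_eq_sum[OF G] V lessThan_atLeast0[symmetric] sum_distrib_right
    by (intro sum.cong) auto
  also have "\<dots> - (\<Sum>j<n. if (i, j) \<in> parcs G then y j else 0)
      = (\<Sum>j<n. if (i, j) \<in> parcs G then y i - y j else 0)"
    unfolding sum_subtractf[symmetric] by (intro sum.cong) auto
  finally show ?thesis .
qed

text \<open>The differences along the two arcs of an edge cancel. This yields both conservation of
  chips and the existence of the eigenvalue 0.\<close>

lemma laplacian_total_zero:
  assumes G: "pair_graph G" and V: "pverts G = {0..<n}"
  shows "(\<Sum>i<n. \<Sum>j<n. laplacian G $$ (i, j) * y j) = 0"
proof -
  define T where "T = (\<Sum>i<n. \<Sum>j<n. if (i, j) \<in> parcs G then y i - y j else 0)"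
  have "T = (\<Sum>i<n. \<Sum>j<n. if (j, i) \<in> parcs G then y j - y i else 0)"
    unfolding T_def by (rule sum.swap)
  also have "\<dots> = - T"
    unfolding T_def sum_negf[symmetric]
    by (intro sum.cong) (auto simp: parcs_sym_iff[OF G])
  finally show ?thesis by (simp add: laplacian_sum[OF G V] T_def)
qed

text \<open>The sum over ordered pairs meets each edge twice, hence the division by 2.\<close>

lemma laplacian_quadratic_form:
  assumes G: "pair_graph G" and V: "pverts G = {0..<n}"
  shows "(\<Sum>i<n. y i * (\<Sum>j<n. laplacian G $$ (i, j) * y j))
    = (\<Sum>i<n. \<Sum>j<n. if (i, j) \<in> parcs G then (y i - y j)\<^sup>2 else 0) / 2"
proof -
  define T where "T = (\<Sum>i<n. \<Sum>j<n. if (i, j) \<in> parcs G then y i * (y i - y j) else 0)"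
  have "T = (\<Sum>i<n. \<Sum>j<n. if (j, i) \<in> parcs G then y j * (y j - y i) else 0)"
    unfolding T_def by (rule sum.swap)
  then have "T + T = (\<Sum>i<n. \<Sum>j<n. (if (i, j) \<in> parcs G then y i * (y i - y j) else 0)
      + (if (j, i) \<in> parcs G then y j * (y j - y i) else 0))"
    by (simp add: T_def sum.distrib)
  also have "\<dots> = (\<Sum>i<n. \<Sum>j<n. if (i, j) \<in> parcs G then (y i - y j)\<^sup>2 else 0)"
    by (intro sum.cong)
      (use parcs_sym_iff[OF G] in \<open>auto simp: power2_eq_square algebra_simps\<close>)
  moreover have "(\<Sum>i<n. y i * (\<Sum>j<n. laplacian G $$ (i, j) * y j)) = T"
    unfolding T_def using laplacian_sum[OF G V]
    by (intro sum.cong) (auto simp: sum_distrib_left intro!: sum.cong)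
  ultimately show ?thesis by simp
qed

text \<open>For a kernel vector the quadratic form vanishes, so \<open>y\<close> agrees at the two
  ends of every arc; connectivity spreads this to all vertices.\<close>

lemma laplacian_kernel_constant:
  fixes y :: "nat \<Rightarrow> real"
  assumes G: "pair_graph G" and V: "pverts G = {0..<n}"
    and con: "Digraph_Component.connected (with_proj G)"
    and ker: "\<And>i. i < n \<Longrightarrow> (\<Sum>j<n. laplacian G $$ (i, j) * y j) = 0"
    and "u < n" "v < n"
  shows "y u = y v"
proof -
  interpret pair_graph G by fact
  have "(\<Sum>i<n. \<Sum>j<n. if (i, j) \<in> parcs G then (y i - y j)\<^sup>2 else 0) = 0"
    using laplacian_quadratic_form[OF G V, of y] ker by simp
  then have edge: "y i = y j" if "(i, j) \<in> parcs G" for i j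
    using that in_arcsD1[OF that] in_arcsD2[OF that] V
    by (force simp: sum_nonneg_eq_0_iff sum_nonneg)
  have "strongly_connected (with_proj G)"
    using symmetric_connected_imp_strongly_connected[OF pair_sym_arcs con] .
  then have "u \<rightarrow>\<^sup>*\<^bsub>with_proj G\<^esub> v"
    using assms(5,6) V by (auto simp: strongly_connected_def)
  then show ?thesis
    by (induction rule: reachable_induct) (auto dest: edge)
qed

lemma laplacian_symmetric:
  assumes G: "pair_graph G" and V: "pverts G = {0..<n}"
  shows "(laplacian G)\<^sup>T = laplacian G"
  using V by (intro eq_matI) (auto simp: laplacian_def parcs_sym_iff[OF G])

text \<open>Kernel vectors are constant, so the eigenvalue 0 is simple. The eigenvector
  \<open>f 0\<close> is fixed only up to sign, which is why it is described through products of its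
  entries.\<close>

lemma connected_laplacian_eigenbasis:
  fixes G :: "nat pair_pre_digraph"
  defines "ev \<equiv> (!) (laplacian_spectrum G)"
  assumes G: "pair_graph G" and V: "pverts G = {0..<n}" and n: "n > 0"
    and con: "Digraph_Component.connected (with_proj G)"
  obtains f :: "nat \<Rightarrow> nat \<Rightarrow> real"
  where "\<And>i j. i < n \<Longrightarrow> j < n \<Longrightarrow> (\<Sum>k<n. f k i * f k j) = (if i = j then 1 else 0)"
    and "\<And>k i. k < n \<Longrightarrow> i < n \<Longrightarrow> (\<Sum>j<n. laplacian G $$ (i, j) * f k j) = ev k * f k i"
    and "\<And>i j. i < n \<Longrightarrow> j < n \<Longrightarrow> f 0 i * f 0 j = 1 / real n"
    and "ev 0 = 0"
    and "\<And>k. 0 < k \<Longrightarrow> k < n \<Longrightarrow> ev k > 0"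
proof -
  let ?L = "laplacian G"
  have L: "?L \<in> carrier_mat n n"
    using laplacian_carrier[of G] V by simp
  obtain f :: "nat \<Rightarrow> nat \<Rightarrow> real" where
    orth: "\<And>k l. k < n \<Longrightarrow> l < n \<Longrightarrow> (\<Sum>i<n. f k i * f l i) = (if k = l then 1 else 0)" and
    complete: "\<And>i j. i < n \<Longrightarrow> j < n \<Longrightarrow> (\<Sum>k<n. f k i * f k j) = (if i = j then 1 else 0)" and
    eig: "\<And>k i. k < n \<Longrightarrow> i < n \<Longrightarrow> (\<Sum>j<n. ?L $$ (i, j) * f k j) = ev k * f k i"
    using symmetric_orthonormal_eigenbasis[OF L laplacian_symmetric[OF G V]
        char_poly_laplacian(3)[OF G V]]
    unfolding ev_def by blast
  have nonneg: "ev k \<ge> 0" if k: "k < n" for k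
  proof -
    have "(\<Sum>i<n. f k i * (\<Sum>j<n. ?L $$ (i, j) * f k j)) = (\<Sum>i<n. ev k * (f k i * f k i))"
      using eig[OF k] by (intro sum.cong) auto
    also have "\<dots> = ev k"
      using orth[OF k k] by (simp flip: sum_distrib_left)
    finally have "ev k = (\<Sum>i<n. f k i * (\<Sum>j<n. ?L $$ (i, j) * f k j))" ..
    also have "\<dots> \<ge> 0"
      unfolding laplacian_quadratic_form[OF G V] by (simp add: sum_nonneg)
    finally show ?thesis .
  qed
  have const: "f k i = f k j" if "k < n" "ev k = 0" "i < n" "j < n" for k i j
    using laplacian_kernel_constant[OF G V con, of "f k" i j] eig[of k] that by simp
  have inner: "(\<Sum>i<n. f k i * f l i) = real n * (f k 0 * f l 0)"
    if "k < n" "l < n" "ev k = 0" "ev l = 0" for k l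
  proof -
    define c where "c = f k 0 * f l 0"
    have "f k i * f l i = c" if "i < n" for i
      using const[of k i 0] const[of l i 0] \<open>k < n\<close> \<open>l < n\<close> \<open>ev k = 0\<close> \<open>ev l = 0\<close> that n
      by (simp add: c_def)
    then show ?thesis by (simp add: c_def[symmetric])
  qed
  \<comment> \<open>If \<open>k\<close> and \<open>l\<close> differed, orthogonality would give
    \<open>f k 0 * f l 0 = 0\<close>, contradicting the unit norms of these two constant
    vectors.\<close>
  have simple: "k = l" if "k < n" "l < n" "ev k = 0" "ev l = 0" for k l
    using inner[of k k] inner[of k l] inner[of l l] orth[of k k] orth[of k l] orth[of l l] that
    by (auto split: if_splits)
  \<comment> \<open>Otherwise every eigenvector would have entry sum 0, and by completeness so would
    the first unit vector.\<close>
  have "\<exists>k<n. ev k = 0"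
  proof (rule ccontr)
    assume none: "\<not> (\<exists>k<n. ev k = 0)"
    have zero: "(\<Sum>i<n. f k i) = 0" if k: "k < n" for k
    proof -
      have "ev k * (\<Sum>i<n. f k i) = (\<Sum>i<n. \<Sum>j<n. ?L $$ (i, j) * f k j)"
        using eig[OF k] by (simp add: sum_distrib_left)
      also have "\<dots> = 0" by (rule laplacian_total_zero[OF G V])
      finally show ?thesis using none k by simp
    qed
    have "1 = (\<Sum>j<n. \<Sum>k<n. f k 0 * f k j)"
      using complete[of 0] n by simp
    also have "\<dots> = (\<Sum>k<n. \<Sum>j<n. f k 0 * f k j)"
      by (rule sum.swap)
    also have "\<dots> = 0"
      using zero by (simp flip: sum_distrib_left)
    finally show False by simp
  qed
  then obtain k where k: "k < n" "ev k = 0" by blast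
  have "ev 0 \<le> ev k"
    unfolding ev_def using k(1) char_poly_laplacian(1,2)[OF G V] by (intro sorted_nth_mono) auto
  with k nonneg[of 0] n have ev0: "ev 0 = 0" by simp
  show thesis
  proof (rule that[of f])
    fix i j assume "i < n" "j < n"
    then show "f 0 i * f 0 j = 1 / real n"
      using inner[of 0 0] orth[of 0 0] const[of 0 i 0] const[of 0 j 0] ev0 n
      by (simp add: field_simps)
  next
    fix k assume "0 < k" "k < n"
    then show "ev k > 0"
      using simple[of k 0] nonneg[of k] ev0 n by (metis less_le)
  qed (use complete eig ev0 in auto)
qed

section \<open>Chip-firing expressed through the Laplacian\<close>

lemma legal_game_laplacian:
  assumes G: "pair_graph G" and V: "pverts G = {0..<n}" and game: "legal_game G a vs b" and "i < n"
  shows "(\<Sum>j<n. laplacian G $$ (i, j) * real (count_list vs j)) = real (a i) - real (b i)"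
proof -
  have "(\<Sum>j<n. laplacian G $$ (i, j) * real (count_list vs j))
      = (\<Sum>j<n. (if i = j then real (vertex_degree G i) * real (count_list vs i) else 0)
          - (if (j, i) \<in> parcs G then real (count_list vs j) else 0))"
    using \<open>i < n\<close>
    by (intro sum.cong)
      (auto simp: laplacian_entry[OF G V] left_diff_distrib parcs_sym_iff[OF G, of i])
  also have "\<dots> = real (a i) - real (b i)"
    using \<open>i < n\<close> legal_game_balance[OF G game, of i] V
    by (simp add: sum_subtractf lessThan_atLeast0)
  finally show ?thesis .
qed

lemma legal_game_num_chips:
  fixes G :: "nat pair_pre_digraph"
  assumes G: "pair_graph G" and V: "pverts G = {0..<n}" and "legal_game G a vs b"
  shows "num_chips G b = num_chips G a"
proof -
  have "(\<Sum>i<n. real (a i) - real (b i))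
      = (\<Sum>i<n. \<Sum>j<n. laplacian G $$ (i, j) * real (count_list vs j))"
    using legal_game_laplacian[OF assms] by (intro sum.cong) auto
  also have "\<dots> = 0" by (rule laplacian_total_zero[OF G V])
  finally have "(\<Sum>i<n. real (a i)) = (\<Sum>i<n. real (b i))" by (simp add: sum_subtractf)
  then show ?thesis
    unfolding num_chips_def V lessThan_atLeast0 by (simp flip: of_nat_sum)
qed

section \<open>Bounding the firings through the entries of the pseudoinverse\<close>

theorem mainTheorem5:
  fixes G :: "nat pair_pre_digraph" and n N s :: nat
    and a b :: "nat config" and vs :: "nat list"
    and \<delta> lam2 lamn :: real
  assumes "pair_graph G" and "pverts G = {0..<n}" and "n \<ge> 2"
    and "Digraph_Component.connected (with_proj G)"
    and "\<delta> = real (min_degree G)"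
    and "lam2 = laplacian_eigenvalue G 2"
    and "lamn = laplacian_eigenvalue G n"
    and "terminating_game G a vs b"
    and "N = num_chips G a"
    and "s = length vs"
  shows "real s \<le> 2 * real n * real N *
    ((lam2 + lamn * (real n - 1) / real n - \<delta>) / (lam2 * lamn))"
proof -
  note G = assms(1) and V = assms(2)
  define L where "L i j = laplacian G $$ (i, j)" for i j
  define ev where "ev = (!) (laplacian_spectrum G)"
  have n: "n > 0" using assms(3) by simp
  obtain f :: "nat \<Rightarrow> nat \<Rightarrow> real" where
    complete: "\<And>i j. i < n \<Longrightarrow> j < n \<Longrightarrow> (\<Sum>k<n. f k i * f k j) = (if i = j then 1 else 0)" and
    eig: "\<And>k i. k < n \<Longrightarrow> i < n \<Longrightarrow> (\<Sum>j<n. L i j * f k j) = ev k * f k i" and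
    f0: "\<And>i j. i < n \<Longrightarrow> j < n \<Longrightarrow> f 0 i * f 0 j = 1 / real n" and
    ev0: "ev 0 = 0" and
    ev_pos: "\<And>k. 0 < k \<Longrightarrow> k < n \<Longrightarrow> ev k > 0"
    using connected_laplacian_eigenbasis[OF G V n assms(4)] unfolding ev_def L_def by blast
  \<comment> \<open>Eigenvalues are counted from 1, whereas \<open>ev\<close> is indexed from
    0.\<close>
  have lam: "lam2 = ev 1" "lamn = ev (n - 1)"
    by (simp_all add: assms laplacian_eigenvalue_def ev_def)
  have ev_mono: "ev k \<le> ev l" if "k \<le> l" "l < n" for k l
    unfolding ev_def using that char_poly_laplacian(1,2)[OF G V] by (intro sorted_nth_mono) auto
  have ev_bounds: "lam2 \<le> ev k" "ev k \<le> lamn" if "0 < k" "k < n" for k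
    using that ev_mono[of 1 k] ev_mono[of k "n - 1"] by (auto simp: lam)
  have pos: "lam2 > 0" "lamn > 0"
    using ev_pos[of 1] ev_pos[of "n - 1"] assms(3) by (auto simp: lam)
  have split0: "(\<Sum>k<n. g k) = g 0 + (\<Sum>k\<in>{1..<n}. g k)" for g :: "nat \<Rightarrow> real"
    using n by (simp add: lessThan_atLeast0 sum.atLeast_Suc_lessThan)
  \<comment> \<open>\<open>Q\<close> will bound every entry of the pseudoinverse, so the goal
    becomes \<open>s / n \<le> 2 N Q\<close>.\<close>
  define Q where "Q = (lam2 + lamn * (real n - 1) / real n - \<delta>) / (lam2 * lamn)"

  have diag: "(\<Sum>k\<in>{1..<n}. (f k i)\<^sup>2 / ev k) \<le> Q" if i: "i < n" for i
  proof -
    \<comment> \<open>Spectral expansion of the single diagonal entry \<open>L i i\<close>.\<close>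
    have "(\<Sum>k<n. ev k * (f k i)\<^sup>2) = (\<Sum>k<n. \<Sum>j<n. L i j * (f k j * f k i))"
      using i by (intro sum.cong refl)
        (simp add: power2_eq_square mult.assoc[symmetric] eig[symmetric] sum_distrib_right)
    also have "\<dots> = (\<Sum>j<n. L i j * (\<Sum>k<n. f k j * f k i))"
      by (subst sum.swap) (simp add: sum_distrib_left)
    also have "\<dots> = (\<Sum>j<n. if i = j then L i j else 0)"
      using complete i by (intro sum.cong) auto
    also have "\<dots> = real (vertex_degree G i)"
      using i V by (simp add: L_def laplacian_def)
    finally have trace: "(\<Sum>k<n. ev k * (f k i)\<^sup>2) = real (vertex_degree G i)" .
    have norm: "(\<Sum>k<n. (f k i)\<^sup>2) = 1"
      using complete[OF i i] by (simp add: power2_eq_square)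
    have "\<delta> \<le> real (vertex_degree G i)"
      unfolding assms(5) min_degree_def using i V by (auto intro!: Min_le)
    then have low: "(\<Sum>k\<in>{1..<n}. ev k * (f k i)\<^sup>2) \<ge> \<delta>"
      using trace by (simp add: split0 ev0)
    \<comment> \<open>The constant eigenvector accounts for \<open>1 / n\<close> of the unit mass.
      In \<open>low\<close> the same index contributes nothing because
      \<open>ev 0 = 0\<close>.\<close>
    have mass: "(\<Sum>k\<in>{1..<n}. (f k i)\<^sup>2) = 1 - 1 / real n"
      using norm f0[OF i i] by (simp add: split0 power2_eq_square)
    have "(\<Sum>k\<in>{1..<n}. (f k i)\<^sup>2 / ev k)
        \<le> (\<Sum>k\<in>{1..<n}. (f k i)\<^sup>2 * ((lam2 + lamn - ev k) / (lam2 * lamn)))"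
    proof (rule sum_mono)
      fix k assume "k \<in> {1..<n}"
      then have k: "0 < k" "k < n" by auto
      \<comment> \<open>Expanded, this says
        \<open>lam2 * lamn \<le> ev k * (lam2 + lamn - ev k)\<close>, which is the linear bound on
        \<open>1 / ev k\<close>.\<close>
      have "(ev k - lam2) * (lamn - ev k) \<ge> 0"
        using ev_bounds[OF k] by simp
      then have "1 / ev k \<le> (lam2 + lamn - ev k) / (lam2 * lamn)"
        using ev_pos[OF k] pos by (simp add: field_simps)
      from mult_left_mono[OF this zero_le_power2[of "f k i"]]
      show "(f k i)\<^sup>2 / ev k \<le> (f k i)\<^sup>2 * ((lam2 + lamn - ev k) / (lam2 * lamn))"
        by simp
    qed
    also have "\<dots> = ((lam2 + lamn) * (\<Sum>k\<in>{1..<n}. (f k i)\<^sup>2)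
        - (\<Sum>k\<in>{1..<n}. ev k * (f k i)\<^sup>2)) / (lam2 * lamn)"
      unfolding sum_distrib_left sum_subtractf[symmetric] sum_divide_distrib
      by (intro sum.cong) (simp_all add: algebra_simps)
    also have "\<dots> \<le> Q"
      unfolding Q_def mass
    proof (rule divide_right_mono)
      \<comment> \<open>The two sides differ exactly by \<open>lam2 / n\<close>, which is given away
        here.\<close>
      have "(lam2 + lamn) * (1 - 1 / real n) \<le> lam2 + lamn * (real n - 1) / real n"
        using pos n by (simp add: field_simps)
      then show "(lam2 + lamn) * (1 - 1 / real n) - (\<Sum>k\<in>{1..<n}. ev k * (f k i)\<^sup>2)
          \<le> lam2 + lamn * (real n - 1) / real n - \<delta>"
        using low by linarith
    qed (use pos in simp)
    finally show ?thesis .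
  qed

  \<comment> \<open>\<open>M\<close> is the pseudoinverse of the Laplacian.\<close>
  define M where "M i j = (\<Sum>k\<in>{1..<n}. f k i * f k j / ev k)" for i j
  have M: "\<bar>M i j\<bar> \<le> Q" if "i < n" "j < n" for i j
  proof -
    have "\<bar>M i j\<bar> \<le> (\<Sum>k\<in>{1..<n}. \<bar>f k i * f k j / ev k\<bar>)"
      unfolding M_def by (rule sum_abs)
    also have "\<dots> \<le> (\<Sum>k\<in>{1..<n}. ((f k i)\<^sup>2 / ev k + (f k j)\<^sup>2 / ev k) / 2)"
    proof (rule sum_mono)
      fix k assume "k \<in> {1..<n}"
      then have "ev k > 0" using ev_pos by simp
      \<comment> \<open>The arithmetic-geometric mean inequality, applied per eigenvector, reduces
        an off-diagonal entry to the average of two diagonal ones.\<close>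
      moreover have "\<bar>f k i * f k j\<bar> \<le> ((f k i)\<^sup>2 + (f k j)\<^sup>2) / 2"
        using sum_squares_bound[of "\<bar>f k i\<bar>" "\<bar>f k j\<bar>"] by (simp add: abs_mult)
      ultimately show "\<bar>f k i * f k j / ev k\<bar> \<le> ((f k i)\<^sup>2 / ev k + (f k j)\<^sup>2 / ev k) / 2"
        by (simp add: field_simps abs_mult)
    qed
    also have "\<dots> \<le> Q"
      using diag[OF that(1)] diag[OF that(2)]
      by (simp add: sum.distrib flip: sum_divide_distrib)
    finally show ?thesis .
  qed

  have game: "legal_game G a vs b"
    using assms(8) by (simp add: terminating_game_def)
  have "pverts G \<noteq> {}" using V n by simp
  then obtain z where "z \<in> pverts G" "z \<notin> set vs"
    using terminating_game_unfired_vertex[OF G _ assms(8)] by blast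
  then have z: "z < n" "count_list vs z = 0"
    using V by (auto simp: count_list_0_iff)
  define x where "x i = real (count_list vs i)" for i
  define d where "d i = real (a i) - real (b i)" for i
  have Lx: "(\<Sum>j<n. L i j * x j) = d i" if "i < n" for i
    using legal_game_laplacian[OF G V game that] by (simp add: L_def x_def d_def)
  have L_sym: "L i j = L j i" if "i < n" "j < n" for i j
    using that V by (simp add: L_def laplacian_def parcs_sym_iff[OF G, of i])
  have "set vs \<subseteq> {..<n}"
    using legal_game_subset[OF game] V by auto
  then have s: "real s = (\<Sum>i<n. x i)"
    unfolding x_def assms(10) of_nat_sum[symmetric]
    using sum_count_set[of vs "{..<n}"] by simp
  \<comment> \<open>Coordinates of the firing vector \<open>x\<close> in the eigenbasis.\<close>
  define \<xi> where "\<xi> k = (\<Sum>i<n. f k i * x i)" for k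
  \<comment> \<open>Pairing \<open>L x = d\<close> with \<open>f k\<close> and moving
    \<open>L\<close> across by symmetry.\<close>
  have \<xi>: "ev k * \<xi> k = (\<Sum>j<n. f k j * d j)" if k: "k < n" for k
  proof -
    have "ev k * \<xi> k = (\<Sum>i<n. \<Sum>j<n. L i j * f k j * x i)"
      unfolding \<xi>_def sum_distrib_left
      using eig[OF k] by (intro sum.cong) (simp_all flip: sum_distrib_right mult.assoc)
    also have "\<dots> = (\<Sum>j<n. \<Sum>i<n. L i j * f k j * x i)"
      by (rule sum.swap)
    also have "\<dots> = (\<Sum>j<n. f k j * (\<Sum>i<n. L j i * x i))"
      unfolding sum_distrib_left using L_sym by (intro sum.cong) auto
    finally show ?thesis using Lx by simp
  qed
  have "0 = (\<Sum>i<n. x i * (\<Sum>k<n. f k i * f k z))"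
    using complete z by (simp add: x_def if_distrib[of "(*) _"] cong: if_cong)
  also have "\<dots> = (\<Sum>k<n. \<xi> k * f k z)"
    unfolding \<xi>_def sum_distrib_left sum_distrib_right
    by (subst sum.swap) (simp add: mult_ac)
  also have "\<dots> = real s / real n + (\<Sum>k\<in>{1..<n}. \<xi> k * f k z)"
  proof -
    have "\<xi> 0 * f 0 z = (\<Sum>i<n. (f 0 i * f 0 z) * x i)"
      unfolding \<xi>_def sum_distrib_right by (simp add: mult_ac)
    also have "\<dots> = real s / real n"
      using f0 z by (simp add: s sum_divide_distrib)
    finally show ?thesis by (simp add: split0)
  qed
  also have "(\<Sum>k\<in>{1..<n}. \<xi> k * f k z) = (\<Sum>k\<in>{1..<n}. \<Sum>j<n. f k z * f k j / ev k * d j)"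
  proof (intro sum.cong refl)
    fix k assume "k \<in> {1..<n}"
    then have "\<xi> k = (\<Sum>j<n. f k j * d j) / ev k"
      using \<xi>[of k] ev_pos[of k] by (simp add: field_simps)
    then show "\<xi> k * f k z = (\<Sum>j<n. f k z * f k j / ev k * d j)"
      by (simp add: sum_divide_distrib sum_distrib_left mult_ac)
  qed
  also have "\<dots> = (\<Sum>j<n. M z j * d j)"
    unfolding M_def sum_distrib_right by (rule sum.swap)
  finally have "real s / real n = - (\<Sum>j<n. M z j * d j)" by simp
  also have "\<dots> \<le> (\<Sum>j<n. \<bar>M z j * d j\<bar>)"
    using sum_abs[of "\<lambda>j. M z j * d j" "{..<n}"] by linarith
  also have "\<dots> \<le> (\<Sum>j<n. Q * (real (a j) + real (b j)))"
  proof (rule sum_mono)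
    fix j assume "j \<in> {..<n}"
    then have "\<bar>M z j\<bar> * \<bar>d j\<bar> \<le> Q * (real (a j) + real (b j))"
      using M[OF z(1), of j] by (intro mult_mono) (auto simp: d_def)
    then show "\<bar>M z j * d j\<bar> \<le> Q * (real (a j) + real (b j))" by (simp add: abs_mult)
  qed
  also have "\<dots> = Q * (real (num_chips G a) + real (num_chips G b))"
    by (simp add: num_chips_def V lessThan_atLeast0 sum.distrib flip: sum_distrib_left)
  also have "\<dots> = 2 * real N * Q"
    by (simp add: legal_game_num_chips[OF G V game] assms(9))
  finally show ?thesis
    using n unfolding Q_def by (simp add: field_simps)
qed

end
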